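(* Let $S$ be a $\mathrm{Cu}$-semigroup satisfying (O5). Let $K$ be a closed subcone of $F(S)$ with $0\in K$, and let $\mu\in F(S)\setminus K$. Then there exist $x,y\in S$ such that $\widehat x|_K\le\widehat y|_K$ and $\widehat x(\mu)>\widehat y(\mu)$.
   Context: A $\mathrm{Cu}$-semigroup is a commutative, partially ordered monoid $S$ (order compatible with addition) with $0\le x$ for all $x$, such that: (O1) every increasing sequence has a supremum; (O2) every $x\in S$ is the supremum of a sequence $(x_n)_n$ with $x_n\ll x_{n+1}$ for all $n$; (O3) $x_1\ll x_2$ and $y_1\ll y_2$ imply $x_1+y_1\ll x_2+y_2$; (O4) $\sup_n(x_n+y_n)=\sup_nx_n+\sup_ny_n$ for increasing sequences. Here $x\ll y$ means: for every increasing sequence $(y_n)_n$ with $y\le\sup_ny_n$ there is $n$ with $x\le y_n$. (O5): for all $x'\ll x\le y$ there is $z$ with $x'+z\le y\le x+z$; moreover, if $x+w\le y$ and $w'\ll w$, then $z$ may be chosen with $w'\ll z$. A functional on $S$ is an order-preserving monoid homomorphism $\lambda\colon S\to[0,\infty]$ preserving suprema of increasing sequences. $F(S)$ is the set of functionals, with pointwise addition and pointwise multiplication by scalars in $(0,\infty)$, endowed with the compact Hausdorff topology in which a net $\lambda_j\to\lambda$ iff $\limsup_j\lambda_j(x')\le\lambda(x)\le\liminf_j\lambda_j(x)$ for all $x'\ll x$ in $S$. For $x\in S$, $\widehat x\colon F(S)\to[0,\infty]$ is $\widehat x(\lambda)=\lambda(x)$. $0\in F(S)$ is the zero functional. A subcone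 of $F(S)$ is a subset closed under addition and under multiplication by scalars in $(0,\infty)$ (and having a neutral element, which is automatic here since it contains $0$). *)

theory Defs
  imports "HOL-Analysis.Analysis"
begin

context order
begin

definition is_seq_sup :: "(nat \<Rightarrow> 'a) \<Rightarrow> 'a \<Rightarrow> bool"
  where "is_seq_sup f s \<longleftrightarrow> (\<forall>n. f n \<le> s) \<and> (\<forall>u. (\<forall>n. f n \<le> u) \<longrightarrow> s \<le> u)"

text \<open>The constant \<open>incseq\<close> is not available inside a class context; \<open>monotone (\<le>) (\<le>) f\<close> is
  what it abbreviates.\<close>

definition way_below :: "'a \<Rightarrow> 'a \<Rightarrow> bool"  (infix \<open>\<lless>\<close> 50)
  where "x \<lless> y \<longleftrightarrow> (\<forall>f s. monotone (\<le>) (\<le>) f \<longrightarrow> is_seq_sup f s \<longrightarrow> y \<le> s \<longrightarrow> (\<exists>n. x \<le> f n))"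

end

class cu_semigroup = ordered_comm_monoid_add +
  assumes zero_least: "0 \<le> x"
    and O1: "monotone (\<le>) (\<le>) f \<Longrightarrow> \<exists>s. is_seq_sup f s"
    and O2: "\<exists>f. (\<forall>n. f n \<lless> f (Suc n)) \<and> is_seq_sup f x"
    and O3: "x1 \<lless> x2 \<Longrightarrow> y1 \<lless> y2 \<Longrightarrow> x1 + y1 \<lless> x2 + y2"
    and O4: "monotone (\<le>) (\<le>) f \<Longrightarrow> monotone (\<le>) (\<le>) g \<Longrightarrow> is_seq_sup f s \<Longrightarrow> is_seq_sup g t
               \<Longrightarrow> is_seq_sup (\<lambda>n. f n + g n) (s + t)"

class cu_semigroup_O5 = cu_semigroup +
  assumes O5: "x' \<lless> x \<Longrightarrow> x \<le> y \<Longrightarrow> \<exists>z. x' + z \<le> y \<and> y \<le> x + z"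
    and O5_strong: "x' \<lless> x \<Longrightarrow> x \<le> y \<Longrightarrow> x + w \<le> y \<Longrightarrow> w' \<lless> w
               \<Longrightarrow> \<exists>z. x' + z \<le> y \<and> y \<le> x + z \<and> w' \<lless> z"

definition functionals :: "('a::cu_semigroup \<Rightarrow> ennreal) set"
  where "functionals = {l. mono l \<and> l 0 = 0 \<and> (\<forall>x y. l (x + y) = l x + l y) \<and>
    (\<forall>f s. incseq f \<longrightarrow> is_seq_sup f s \<longrightarrow> l s = (SUP n. l (f n)))}"

definition hat :: "'a::cu_semigroup \<Rightarrow> ('a \<Rightarrow> ennreal) \<Rightarrow> ennreal"
  where "hat x l = l x"

definition functional_conv ::
    "('i \<Rightarrow> 'a::cu_semigroup \<Rightarrow> ennreal) \<Rightarrow> ('a \<Rightarrow> ennreal) \<Rightarrow> 'i filter \<Rightarrow> bool"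
  where "functional_conv f l F \<longleftrightarrow>
    (\<forall>x' x. x' \<lless> x \<longrightarrow> Limsup F (\<lambda>i. f i x') \<le> l x \<and> l x \<le> Liminf F (\<lambda>i. f i x))"

text \<open>Nets in the space of functionals are represented by filters on it: a set is open iff every
  filter converging to one of its points is eventually in it.  Lemma \<open>limitin_functional_topology\<close>
  below shows that convergence in this topology is exactly \<open>functional_conv\<close>.\<close>

definition functional_topology :: "('a::cu_semigroup \<Rightarrow> ennreal) topology"
  where "functional_topology = topology (\<lambda>U. U \<subseteq> functionals \<and>
    (\<forall>l\<in>U. \<forall>F. F \<le> principal functionals \<longrightarrow> functional_conv (\<lambda>k. k) l F
               \<longrightarrow> eventually (\<lambda>k. k \<in> U) F))"

definition subcone :: "('a::cu_semigroup \<Rightarrow> ennreal) set \<Rightarrow> bool"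
  where "subcone K \<longleftrightarrow> K \<subseteq> functionals \<and>
    (\<forall>k\<in>K. \<forall>l\<in>K. (\<lambda>x. k x + l x) \<in> K) \<and>
    (\<forall>c::real. c > 0 \<longrightarrow> (\<forall>k\<in>K. (\<lambda>x. ennreal c * k x) \<in> K)) \<and>
    (\<exists>e\<in>K. \<forall>k\<in>K. (\<lambda>x. e x + k x) = k)"

lemma openin_functional_topology:
  "openin functional_topology U \<longleftrightarrow> U \<subseteq> functionals \<and>
    (\<forall>l\<in>U. \<forall>F. F \<le> principal functionals \<longrightarrow> functional_conv (\<lambda>k. k) l F
               \<longrightarrow> eventually (\<lambda>k. k \<in> U) F)"
proof -
  let ?P = "\<lambda>U :: ('a \<Rightarrow> ennreal) set. U \<subseteq> functionals \<and>
    (\<forall>l\<in>U. \<forall>F. F \<le> principal functionals \<longrightarrow> functional_conv (\<lambda>k. k) l F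
               \<longrightarrow> eventually (\<lambda>k. k \<in> U) F)"
  have "istopology ?P"
    unfolding istopology_def
  proof (intro conjI allI impI)
    fix S T assume "?P S" "?P T"
    then show "S \<inter> T \<subseteq> functionals" "\<forall>l\<in>S \<inter> T. \<forall>F. F \<le> principal functionals \<longrightarrow>
        functional_conv (\<lambda>k. k) l F \<longrightarrow> eventually (\<lambda>k. k \<in> S \<inter> T) F"
      by (auto simp: eventually_conj_iff)
  next
    fix \<K> assume K: "\<forall>K\<in>\<K>. ?P K"
    then show "\<Union>\<K> \<subseteq> functionals" by blast
    show "\<forall>l\<in>\<Union>\<K>. \<forall>F. F \<le> principal functionals \<longrightarrow>
        functional_conv (\<lambda>k. k) l F \<longrightarrow> eventually (\<lambda>k. k \<in> \<Union>\<K>) F"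
    proof (intro ballI allI impI)
      fix l F assume "l \<in> \<Union>\<K>" and F: "F \<le> principal functionals" "functional_conv (\<lambda>k. k) l F"
      then obtain U where U: "U \<in> \<K>" "l \<in> U" by blast
      with K F have "eventually (\<lambda>k. k \<in> U) F" by blast
      then show "eventually (\<lambda>k. k \<in> \<Union>\<K>) F"
        by (rule eventually_mono) (use U in blast)
    qed
  qed
  then show ?thesis
    unfolding functional_topology_def by (simp add: topology_inverse')
qed

lemma topspace_functional_topology: "topspace functional_topology = functionals"
proof -
  have "openin functional_topology (functionals :: ('a \<Rightarrow> ennreal) set)"
    by (auto simp: openin_functional_topology le_principal)
  then show ?thesis
    by (metis openin_functional_topology openin_subset openin_topspace subset_antisym)
qed

lemma way_below_interpolate:
  fixes x' x :: "'a::cu_semigroup"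
  assumes "x' \<lless> x"
  obtains x'' where "x' \<lless> x''" "x'' \<lless> x"
proof -
  obtain f where f: "\<And>n. f n \<lless> f (Suc n)" "is_seq_sup f x"
    using O2 by blast
  have le: "a \<le> b" if "a \<lless> b" for a b :: 'a
    using that[unfolded way_below_def, rule_format, of "\<lambda>_. b" b]
    by (auto simp: is_seq_sup_def incseq_def)
  have "incseq f" by (intro incseq_SucI le f)
  with f(2) assms obtain n where n: "x' \<le> f n"
    unfolding way_below_def by blast
  have ub: "f m \<le> x" for m
    using f(2) by (auto simp: is_seq_sup_def)
  have "x' \<lless> f (Suc n)"
    using f(1)[of n] n unfolding way_below_def by (meson order_trans)
  moreover have "f (Suc n) \<lless> x"
    using f(1)[of "Suc n"] ub[of "Suc (Suc n)"] unfolding way_below_def by (meson order_trans)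
  ultimately show thesis by (rule that)
qed

lemma functional_conv_filtermap:
  "functional_conv (\<lambda>k. k) l (filtermap f F) \<longleftrightarrow> functional_conv f l F"
  by (simp add: functional_conv_def le_Liminf_iff Limsup_le_iff eventually_filtermap)

lemma limitin_functional_topology:
  assumes "eventually (\<lambda>i. f i \<in> functionals) F"
  shows "limitin functional_topology f l F \<longleftrightarrow> l \<in> functionals \<and> functional_conv f l F"
proof
  assume R: "l \<in> functionals \<and> functional_conv f l F"
  have le: "filtermap f F \<le> principal functionals"
    using assms by (simp add: le_principal eventually_filtermap)
  have conv: "functional_conv (\<lambda>k. k) l (filtermap f F)"
    using R by (simp add: functional_conv_filtermap)
  have "eventually (\<lambda>i. f i \<in> U) F" if U: "openin functional_topology U" "l \<in> U" for U
  proof -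
    have "eventually (\<lambda>k. k \<in> U) (filtermap f F)"
      using U le conv unfolding openin_functional_topology by blast
    then show ?thesis
      by (simp add: eventually_filtermap)
  qed
  with R show "limitin functional_topology f l F"
    by (simp add: limitin_def topspace_functional_topology)
next
  assume L: "limitin functional_topology f l F"
  then have l: "l \<in> functionals"
    by (simp add: limitin_def topspace_functional_topology)
  have "Limsup F (\<lambda>i. f i x') \<le> l x \<and> l x \<le> Liminf F (\<lambda>i. f i x)" if xx: "x' \<lless> x" for x' x
  proof
    show "l x \<le> Liminf F (\<lambda>i. f i x)"
      unfolding le_Liminf_iff
    proof (intro allI impI)
      fix a assume a: "a < l x"
      let ?U = "{k \<in> functionals. a < k x}"
      have "openin functional_topology ?U"
        unfolding openin_functional_topology
      proof (intro conjI ballI allI impI)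
        fix k G assume k: "k \<in> ?U" and G: "G \<le> principal functionals"
          "functional_conv (\<lambda>k. k) k G"
        have "k x \<le> Liminf G (\<lambda>i. i x)"
          using G(2) xx unfolding functional_conv_def by blast
        with k have "eventually (\<lambda>i. a < i x) G"
          by (simp add: le_Liminf_iff)
        with G(1) show "eventually (\<lambda>k. k \<in> ?U) G"
          by (simp add: le_principal eventually_conj_iff)
      qed blast
      with L l a have "eventually (\<lambda>i. f i \<in> ?U) F"
        by (auto simp: limitin_def)
      then show "eventually (\<lambda>i. a < f i x) F"
        by (rule eventually_mono) simp
    qed
    show "Limsup F (\<lambda>i. f i x') \<le> l x"
      unfolding Limsup_le_iff
    proof (intro allI impI)
      fix a assume a: "l x < a"
      let ?U = "{k \<in> functionals. \<exists>y. x' \<lless> y \<and> k y < a}"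
      have "openin functional_topology ?U"
        unfolding openin_functional_topology
      proof (intro conjI ballI allI impI)
        fix k G assume k: "k \<in> ?U" and G: "G \<le> principal functionals"
          "functional_conv (\<lambda>k. k) k G"
        from k obtain y where y: "x' \<lless> y" "k y < a" by blast
        obtain z where z: "x' \<lless> z" "z \<lless> y"
          using y(1) by (rule way_below_interpolate)
        have "Limsup G (\<lambda>i. i z) \<le> k y"
          using G(2) z(2) unfolding functional_conv_def by blast
        with y have "eventually (\<lambda>i. i z < a) G"
          by (simp add: Limsup_le_iff)
        with G(1) have "eventually (\<lambda>i. i \<in> functionals \<and> i z < a) G"
          by (simp add: le_principal eventually_conj_iff)
        then show "eventually (\<lambda>k. k \<in> ?U) G"
          by (rule eventually_mono) (use z(1) in blast)
      qed blast
      with L l a xx have "eventually (\<lambda>i. f i \<in> ?U) F"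
        by (auto simp: limitin_def)
      then show "eventually (\<lambda>i. f i x' < a) F"
      proof (rule eventually_mono)
        fix i assume "f i \<in> ?U"
        then obtain y where y: "mono (f i)" "x' \<lless> y" "f i y < a"
          by (auto simp: functionals_def)
        have "x' \<le> y"
          using y(2)[unfolded way_below_def, rule_format, of "\<lambda>_. y" y]
          by (auto simp: is_seq_sup_def incseq_def)
        with y(1,3) show "f i x' < a"
          by (meson monoD order_le_less_trans)
      qed
    qed
  qed
  with l show "l \<in> functionals \<and> functional_conv f l F"
    by (simp add: functional_conv_def)
qed

end

(* Pointwise limits of functionals are limits in F(S), so K is closed for pointwise convergence and
   mu is separated from K by finitely many conditions l x < a and l y > b.  The values of the
   members of K at these finitely many points form a convex set, and a theorem of alternatives turns
   the separation into one linear inequality with nonnegative real coefficients that is valid on K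
   and fails at mu.  Scaling by a large natural number and rounding (coefficients at the points y
   down, those at the points x up, so that the latter are positive and take care of infinite values)
   makes the coefficients natural numbers, which S can realize as multiples. *)

theory Submission
  imports Defs
begin

section \<open>A theorem of alternatives\<close>

text \<open>A line separates \<open>S\<close> from the open negative quadrant. A linear form bounded
  above on that quadrant has nonnegative coefficients, and letting the points of the quadrant tend
  to the origin shows that the separating constant is nonnegative.\<close>

lemma convex_alternative_pair:
  fixes S :: "(real \<times> real) set"
  assumes "convex S" "S \<noteq> {}" and neg: "\<And>p q. (p, q) \<in> S \<Longrightarrow> p < 0 \<Longrightarrow> 0 \<le> q"
  obtains \<gamma> \<delta> where "0 \<le> \<gamma>" "0 \<le> \<delta>" "0 < \<gamma> \<or> 0 < \<delta>" "\<forall>x\<in>S. 0 \<le> \<gamma> * fst x + \<delta> * snd x"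
proof -
  let ?T = "{..<0::real} \<times> {..<0::real}"
  have "convex ?T" by (intro convex_Times) auto
  moreover have "?T \<noteq> {}" by (auto intro: lt_ex)
  moreover have "?T \<inter> S = {}" using neg by force
  ultimately obtain a b where ab: "a \<noteq> 0" "\<forall>x\<in>?T. inner a x \<le> b" "\<forall>x\<in>S. b \<le> inner a x"
    using separating_hyperplane_sets[of ?T S] assms by metis
  obtain \<gamma> \<delta> where a: "a = (\<gamma>, \<delta>)" by (cases a)
  have T: "\<gamma> * p + \<delta> * q \<le> b" if "p < 0" "q < 0" for p q
    using ab(2) that by (auto simp: a inner_prod_def)
  have g: "0 \<le> \<gamma>"
  proof (rule ccontr)
    assume n: "\<not> 0 \<le> \<gamma>"
    \<comment> \<open>With this \<open>p\<close>, the form at \<open>(p, -1)\<close> equals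
      \<open>\<bar>b\<bar> + \<bar>\<delta>\<bar> + 1 - \<delta>\<close>, which exceeds
      \<open>b\<close>.\<close>
    define p where "p = (\<bar>b\<bar> + \<bar>\<delta>\<bar> + 1) / \<gamma>"
    have "p < 0" using n by (auto simp: p_def intro!: divide_pos_neg)
    moreover have "\<gamma> * p = \<bar>b\<bar> + \<bar>\<delta>\<bar> + 1" using n by (simp add: p_def field_simps)
    ultimately show False using T[of p "-1"] by simp
  qed
  have d: "0 \<le> \<delta>"
  proof (rule ccontr)
    assume n: "\<not> 0 \<le> \<delta>"
    define q where "q = (\<bar>b\<bar> + \<bar>\<gamma>\<bar> + 1) / \<delta>"
    have "q < 0" using n by (auto simp: q_def intro!: divide_pos_neg)
    moreover have "\<delta> * q = \<bar>b\<bar> + \<bar>\<gamma>\<bar> + 1" using n by (simp add: q_def field_simps)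
    ultimately show False using T[of "-1" q] by simp
  qed
  have nz: "0 < \<gamma> \<or> 0 < \<delta>" using ab(1) g d by (auto simp: a zero_prod_def)
  have "0 \<le> b"
  proof (rule ccontr)
    assume n: "\<not> 0 \<le> b"
    \<comment> \<open>Chosen so that the form at \<open>(-e, -e)\<close> equals
      \<open>b / 2\<close>, which exceeds a negative \<open>b\<close>.\<close>
    define e where "e = - b / (2 * (\<gamma> + \<delta>))"
    have pos: "0 < \<gamma> + \<delta>" using g d nz by linarith
    then have "0 < e" using n unfolding e_def by (intro divide_pos_pos) auto
    moreover have "(\<gamma> + \<delta>) * e = - b / 2" using pos by (simp add: e_def divide_simps)
    then have "\<gamma> * (-e) + \<delta> * (-e) = b / 2" by (simp add: algebra_simps)
    ultimately show False using T[of "-e" "-e"] n by simp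
  qed
  then have "\<forall>x\<in>S. 0 \<le> \<gamma> * fst x + \<delta> * snd x"
    using ab(3) by (force simp: a inner_prod_def)
  with g d nz show thesis by (rule that)
qed

text \<open>A Gordan-type alternative for convex sets, by induction on the index set, so that
  hyperplane separation is used only in the plane. The members of \<open>D\<close> that are negative
  at the new index \<open>j\<close> satisfy the hypotheses for \<open>I\<close>; the form obtained
  for them is then combined with the coordinate \<open>j\<close>.\<close>

lemma convex_alternative:
  fixes D :: "('i \<Rightarrow> real) set"
  assumes "finite I" "D \<noteq> {}"
    and "\<And>d e u. d \<in> D \<Longrightarrow> e \<in> D \<Longrightarrow> 0 < u \<Longrightarrow> u < 1 \<Longrightarrow> (\<lambda>i. u * d i + (1 - u) * e i) \<in> D"
    and "\<And>d. d \<in> D \<Longrightarrow> \<exists>i\<in>I. 0 \<le> d i"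
  shows "\<exists>\<alpha>. (\<forall>i\<in>I. 0 \<le> \<alpha> i) \<and> (\<exists>i\<in>I. 0 < \<alpha> i) \<and> (\<forall>d\<in>D. 0 \<le> (\<Sum>i\<in>I. \<alpha> i * d i))"
  using assms
proof (induction I arbitrary: D rule: finite_induct)
  case empty
  then show ?case by auto
next
  case (insert j I)
  define D' where "D' = {d \<in> D. d j < 0}"
  show ?case
  proof (cases "D' = {}")
    case True
    define \<alpha> where "\<alpha> = (\<lambda>i. if i = j then 1 else 0 :: real)"
    have "(\<Sum>i\<in>insert j I. \<alpha> i * d i) = d j" for d
    proof -
      have "(\<Sum>i\<in>I. \<alpha> i * d i) = 0"
        using insert.hyps by (intro sum.neutral) (auto simp: \<alpha>_def)
      then show ?thesis using insert.hyps by (simp add: \<alpha>_def)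
    qed
    with True show ?thesis
      by (intro exI[of _ \<alpha>]) (auto simp: \<alpha>_def D'_def not_less)
  next
    case False
    have conv': "(\<lambda>i. u * d i + (1 - u) * e i) \<in> D'"
      if "d \<in> D'" "e \<in> D'" "0 < u" "u < 1" for d e u
    proof -
      have "u * d j < 0" "(1 - u) * e j < 0"
        using that by (auto simp: D'_def mult_pos_neg)
      then show ?thesis
        using that insert.prems(2) by (auto simp: D'_def)
    qed
    have "\<exists>i\<in>I. 0 \<le> d i" if "d \<in> D'" for d
      using insert.prems(3)[of d] that by (auto simp: D'_def)
    from insert.IH[OF False conv' this] obtain \<alpha> where
      \<alpha>: "\<forall>i\<in>I. 0 \<le> \<alpha> i" "\<exists>i\<in>I. 0 < \<alpha> i" "\<forall>d\<in>D'. 0 \<le> (\<Sum>i\<in>I. \<alpha> i * d i)"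
      by blast
    define g where "g d = (\<Sum>i\<in>I. \<alpha> i * d i)" for d
    have g_comb: "g (\<lambda>i. u * d i + v * e i) = u * g d + v * g e" for u v d e
      by (simp add: g_def sum.distrib sum_distrib_left algebra_simps)
    \<comment> \<open>The induction hypothesis says that \<open>g d\<close> is nonnegative whenever
      \<open>d j\<close> is negative, which is the assumption of the planar case for this image of
      \<open>D\<close>.\<close>
    let ?S = "(\<lambda>d. (d j, g d)) ` D"
    have "convex ?S"
    proof (rule convexI)
      fix x y and u v :: real
      assume "x \<in> ?S" "y \<in> ?S" and uv: "0 \<le> u" "0 \<le> v" "u + v = 1"
      then obtain d e where d: "d \<in> D" "x = (d j, g d)" and e: "e \<in> D" "y = (e j, g e)"
        by blast
      have v: "v = 1 - u" using uv by simp
      consider "u = 0" | "u = 1" | "0 < u" "u < 1" using uv by linarith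
      then show "u *\<^sub>R x + v *\<^sub>R y \<in> ?S"
      proof cases
        case 3
        with insert.prems(2) d e have "(\<lambda>i. u * d i + v * e i) \<in> D" by (simp add: v)
        then show ?thesis
          by (rule rev_image_eqI) (simp add: d e g_comb)
      qed (use d e v in auto)
    qed
    moreover have "?S \<noteq> {}" using insert.prems(1) by simp
    moreover have "0 \<le> q" if "(p, q) \<in> ?S" "p < 0" for p q
      using that \<alpha>(3) by (auto simp: D'_def g_def)
    ultimately obtain \<gamma> \<delta> where gd: "0 \<le> \<gamma>" "0 \<le> \<delta>" "0 < \<gamma> \<or> 0 < \<delta>"
      and S: "\<forall>x\<in>?S. 0 \<le> \<gamma> * fst x + \<delta> * snd x"
      by (rule convex_alternative_pair)
    \<comment> \<open>If \<open>\<gamma>\<close> vanishes then \<open>\<delta>\<close> is positive,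
      and a positive \<open>\<alpha> i\<close> yields a positive \<open>\<beta> i\<close>, since
      \<open>j\<close> is not in \<open>I\<close>.\<close>
    define \<beta> where "\<beta> i = (if i = j then \<gamma> else \<delta> * \<alpha> i)" for i
    have "(\<Sum>i\<in>I. \<beta> i * d i) = \<delta> * g d" for d
      unfolding g_def sum_distrib_left
      using insert.hyps by (intro sum.cong) (auto simp: \<beta>_def)
    then have "(\<Sum>i\<in>insert j I. \<beta> i * d i) = \<gamma> * d j + \<delta> * g d" for d
      using insert.hyps by (simp add: \<beta>_def)
    moreover have "0 \<le> \<gamma> * d j + \<delta> * g d" if "d \<in> D" for d
      using S that by force
    moreover have "\<forall>i\<in>insert j I. 0 \<le> \<beta> i"
      using gd \<alpha> by (auto simp: \<beta>_def)
    moreover have "\<exists>i\<in>insert j I. 0 < \<beta> i"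
      using gd \<alpha> insert.hyps by (auto simp: \<beta>_def)
    ultimately show ?thesis by (intro exI[of _ \<beta>]) simp
  qed
qed

section \<open>Separation from closed subcones\<close>

lemma functional_sum:
  assumes "l \<in> functionals" "finite A"
  shows "l (sum f A) = (\<Sum>i\<in>A. l (f i))"
proof -
  have "l 0 = 0" "\<And>x y. l (x + y) = l x + l y"
    using assms(1) by (simp_all add: functionals_def)
  with assms(2) show ?thesis
    by (induction A rule: finite_induct) simp_all
qed

lemma functional_sum_multiples:
  assumes "l \<in> functionals" "finite A"
  shows "l (\<Sum>i\<in>A. \<Sum>k<n i. f i) = (\<Sum>i\<in>A. of_nat (n i) * l (f i))"
proof -
  have "l (\<Sum>k<n i. f i) = of_nat (n i) * l (f i)" for i
    by (simp add: functional_sum[OF assms(1) finite_lessThan])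
  then show ?thesis
    by (simp add: functional_sum[OF assms])
qed

text \<open>The trace on \<open>K\<close> of the filter of pointwise neighbourhoods of
  \<open>\<mu>\<close> converges to \<open>\<mu>\<close> in the sense of functionals. As the
  complement of \<open>K\<close> is open, this filter is eventually outside \<open>K\<close>, so
  some basic neighbourhood, given by finitely many strict inequalities, misses
  \<open>K\<close>.\<close>

lemma closedin_functional_topology_pointwise:
  fixes K :: "('a::cu_semigroup \<Rightarrow> ennreal) set"
  assumes "closedin functional_topology K" "\<mu> \<in> functionals - K"
  obtains A B :: "('a \<times> real) set" where "finite A" "finite B"
    "\<And>x a. (x, a) \<in> A \<Longrightarrow> \<mu> x < ennreal a"
    "\<And>y b. (y, b) \<in> B \<Longrightarrow> 0 \<le> b \<and> ennreal b < \<mu> y"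
    "\<And>l. l \<in> K \<Longrightarrow> (\<exists>(x, a)\<in>A. ennreal a \<le> l x) \<or> (\<exists>(y, b)\<in>B. l y \<le> ennreal b)"
proof -
  \<comment> \<open>\<open>P\<close> collects the real strict upper bounds on values of
    \<open>\<mu>\<close>, \<open>Q\<close> the real strict lower bounds. Since
    \<open>ennreal\<close> sends negative numbers to 0, nonnegativity in \<open>Q\<close> keeps its
    thresholds faithful.\<close>
  define P where "P = {p :: 'a \<times> real. \<mu> (fst p) < ennreal (snd p)}"
  define Q where "Q = {p :: 'a \<times> real. 0 \<le> snd p \<and> ennreal (snd p) < \<mu> (fst p)}"
  define N where "N c = (case c of Inl p \<Rightarrow> {l. l (fst p) < ennreal (snd p)}
    | Inr p \<Rightarrow> {l :: 'a \<Rightarrow> ennreal. ennreal (snd p) < l (fst p)})" for c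
  define G where "G = (INF c\<in>P <+> Q. principal (N c))"
  define F where "F = inf G (principal K)"
  have K: "K \<subseteq> functionals"
    using assms(1) closedin_subset topspace_functional_topology by blast
  have op: "openin functional_topology (functionals - K)"
    using assms(1) by (simp add: closedin_def topspace_functional_topology)
  have ev: "eventually (\<lambda>l. l \<in> N c) F" if "c \<in> P <+> Q" for c
  proof -
    have "F \<le> principal (N c)"
      using that by (auto simp: F_def G_def intro: le_infI1 INF_lower)
    then show ?thesis by (simp add: le_principal)
  qed
  have "functional_conv (\<lambda>k. k) \<mu> F"
    unfolding functional_conv_def
  proof (intro allI impI conjI)
    fix x' x :: 'a assume "x' \<lless> x"
    then have "x' \<le> x"
      using way_below_def[of x' x] by (auto simp: is_seq_sup_def monotone_def dest: spec[of _ "\<lambda>_. x"])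
    then have le: "\<mu> x' \<le> \<mu> x" using assms(2) by (auto simp: functionals_def dest: monoD)
    show "Limsup F (\<lambda>i. i x') \<le> \<mu> x"
      unfolding Limsup_le_iff
    proof (intro allI impI)
      fix z assume "\<mu> x < z"
      with le have "\<mu> x' < z" by (rule order_le_less_trans)
      \<comment> \<open>The bound \<open>z\<close> may be infinite; an intermediate \<open>a\<close>
        is finite and can serve as a real threshold.\<close>
      then obtain a where a: "\<mu> x' < a" "a < z" using dense by blast
      then obtain r where r: "a = ennreal r" by (cases a) auto
      have "eventually (\<lambda>l. l \<in> N (Inl (x', r))) F"
        using a by (intro ev) (auto simp: P_def r)
      then show "eventually (\<lambda>l. l x' < z) F"
        by (rule eventually_mono) (use a r in \<open>auto simp: N_def\<close>)
    qed
    show "\<mu> x \<le> Liminf F (\<lambda>i. i x)"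
      unfolding le_Liminf_iff
    proof (intro allI impI)
      fix z assume z: "z < \<mu> x"
      then obtain r where r: "z = ennreal r" "0 \<le> r" by (cases z) auto
      have "eventually (\<lambda>l. l \<in> N (Inr (x, r))) F"
        using z r by (intro ev) (auto simp: Q_def)
      then show "eventually (\<lambda>l. z < l x) F"
        by (rule eventually_mono) (auto simp: N_def r)
    qed
  qed
  moreover have "F \<le> principal functionals"
    using K by (auto simp: F_def intro: le_infI2)
  ultimately have "eventually (\<lambda>l. l \<in> functionals - K) F"
    using op assms(2) unfolding openin_functional_topology by blast
  \<comment> \<open>Since \<open>F\<close> is the trace of \<open>G\<close> on \<open>K\<close>,
    being eventually outside \<open>K\<close> passes to \<open>G\<close>. For an infimum of filters,
    finitely many members already force this.\<close>
  then have "eventually (\<lambda>l. l \<notin> K) G"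
    by (simp add: F_def eventually_inf_principal)
  from iffD1[OF eventually_INF this[unfolded G_def]] obtain X where X: "X \<subseteq> P <+> Q" "finite X"
    and evX: "eventually (\<lambda>l. l \<notin> K) (INF c\<in>X. principal (N c))"
    by blast
  have "eventually (\<lambda>l. l \<notin> K) (principal (\<Inter>c\<in>X. N c))"
    using evX by (simp only: INF_principal_finite[OF X(2)])
  then have disj: "l \<notin> K" if "\<And>c. c \<in> X \<Longrightarrow> l \<in> N c" for l
    using that unfolding eventually_principal by blast
  show thesis
  proof (rule that[of "Inl -` X" "Inr -` X"])
    show "finite (Inl -` X)" "finite (Inr -` X)"
      using X(2) by (auto intro: finite_vimageI)
    show "\<mu> x < ennreal a" if "(x, a) \<in> Inl -` X" for x a
      using X(1) that by (auto simp: P_def)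
    show "0 \<le> b \<and> ennreal b < \<mu> y" if "(y, b) \<in> Inr -` X" for y b
      using X(1) that by (auto simp: Q_def)
    show "(\<exists>(x, a)\<in>Inl -` X. ennreal a \<le> l x) \<or> (\<exists>(y, b)\<in>Inr -` X. l y \<le> ennreal b)"
      if l: "l \<in> K" for l
    proof -
      obtain c where "c \<in> X" "l \<notin> N c" using disj l by blast
      then show ?thesis
        by (cases c) (force simp: N_def not_less)+
    qed
  qed
qed

text \<open>The theorem of alternatives applies to the defects \<open>l x - a\<close> and
  \<open>b - l y\<close>, which by \<open>alt\<close> are never all negative. This gives an affine
  inequality; the zero functional fixes the sign of its constant term, and scaling inside the cone
  leaves its homogeneous part.\<close>

lemma subcone_pointwise_alternative:
  fixes K :: "('a::cu_semigroup \<Rightarrow> ennreal) set" and A B :: "('a \<times> real) set"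
  assumes K: "subcone K" and zero: "(\<lambda>x. 0) \<in> K" and fin: "finite A" "finite B"
    and A: "\<And>x a. (x, a) \<in> A \<Longrightarrow> 0 < a" and B: "\<And>y b. (y, b) \<in> B \<Longrightarrow> 0 \<le> b"
    and alt: "\<And>l. l \<in> K \<Longrightarrow> (\<exists>(x, a)\<in>A. ennreal a \<le> l x) \<or> (\<exists>(y, b)\<in>B. l y \<le> ennreal b)"
  obtains \<alpha> \<beta> where "\<forall>p\<in>A. 0 \<le> \<alpha> p" "\<forall>p\<in>B. 0 \<le> \<beta> p" "\<exists>p\<in>B. 0 < \<beta> p"
    "(\<Sum>p\<in>A. \<alpha> p * snd p) \<le> (\<Sum>p\<in>B. \<beta> p * snd p)"
    "\<forall>l\<in>K. \<forall>s t. (\<forall>p\<in>A. 0 \<le> s p \<and> l (fst p) = ennreal (s p)) \<longrightarrow>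
       (\<forall>p\<in>B. 0 \<le> t p \<and> ennreal (t p) \<le> l (fst p)) \<longrightarrow>
       (\<Sum>p\<in>B. \<beta> p * t p) \<le> (\<Sum>p\<in>A. \<alpha> p * s p)"
proof -
  \<comment> \<open>Coordinates in \<open>A\<close> record exact finite values. Those in
    \<open>B\<close> record any finite lower bound of the value, so that functionals infinite at
    points of \<open>B\<close> are represented too.\<close>
  define D where "D = {d. \<exists>l\<in>K.
    (\<forall>p\<in>A. 0 \<le> d (Inl p) + snd p \<and> l (fst p) = ennreal (d (Inl p) + snd p)) \<and>
    (\<forall>p\<in>B. 0 \<le> snd p - d (Inr p) \<and> ennreal (snd p - d (Inr p)) \<le> l (fst p))}"
  have K_scale: "(\<lambda>x. ennreal c * l x) \<in> K" if "0 < c" "l \<in> K" for c l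
    using K that unfolding subcone_def by blast
  have K_add: "(\<lambda>x. k x + l x) \<in> K" if "k \<in> K" "l \<in> K" for k l
    using K that unfolding subcone_def by blast
  have D_mem: "case_sum (\<lambda>p. k * s p - snd p) (\<lambda>p. snd p - k * t p) \<in> D"
    if l: "l \<in> K" "\<And>p. p \<in> A \<Longrightarrow> 0 \<le> s p \<and> l (fst p) = ennreal (s p)"
      "\<And>p. p \<in> B \<Longrightarrow> 0 \<le> t p \<and> ennreal (t p) \<le> l (fst p)" and k: "0 < k" for l s t k
    unfolding D_def
    using l k by (auto simp: ennreal_mult intro!: mult_left_mono bexI[OF _ K_scale[OF k l(1)]])
  have "case_sum (\<lambda>p. 1 * 0 - snd p) (\<lambda>p. snd p - 1 * 0) \<in> D"
    by (rule D_mem[OF zero]) auto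
  then have "D \<noteq> {}" by blast
  moreover have "(\<lambda>i. u * d i + (1 - u) * e i) \<in> D"
    if d: "d \<in> D" and e: "e \<in> D" and u: "0 < u" "u < 1" for d e u
  proof -
    obtain k where k: "k \<in> K"
      "\<And>p. p \<in> A \<Longrightarrow> 0 \<le> d (Inl p) + snd p \<and> k (fst p) = ennreal (d (Inl p) + snd p)"
      "\<And>p. p \<in> B \<Longrightarrow> 0 \<le> snd p - d (Inr p) \<and> ennreal (snd p - d (Inr p)) \<le> k (fst p)"
      using d unfolding D_def by blast
    obtain l where l: "l \<in> K"
      "\<And>p. p \<in> A \<Longrightarrow> 0 \<le> e (Inl p) + snd p \<and> l (fst p) = ennreal (e (Inl p) + snd p)"
      "\<And>p. p \<in> B \<Longrightarrow> 0 \<le> snd p - e (Inr p) \<and> ennreal (snd p - e (Inr p)) \<le> l (fst p)"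
      using e unfolding D_def by blast
    have mem: "(\<lambda>x. ennreal u * k x + ennreal (1 - u) * l x) \<in> K"
      using K_add[OF K_scale[OF u(1) k(1)] K_scale[OF _ l(1), of "1 - u"]] u by simp
    have comb: "0 \<le> u * r + (1 - u) * s \<and>
        ennreal (u * r + (1 - u) * s) = ennreal u * ennreal r + ennreal (1 - u) * ennreal s"
      if "0 \<le> r" "0 \<le> s" for r s
      using that u by (simp add: ennreal_mult)
    \<comment> \<open>The shifts by thresholds commute with convex combinations because the weights
      add up to 1.\<close>
    have eqA: "u * d i + (1 - u) * e i + c = u * (d i + c) + (1 - u) * (e i + c)" for i c
      by (simp add: algebra_simps)
    have eqB: "c - (u * d i + (1 - u) * e i) = u * (c - d i) + (1 - u) * (c - e i)" for i c
      by (simp add: algebra_simps)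
    show ?thesis
      unfolding D_def mem_Collect_eq eqA eqB
    proof (intro bexI[OF _ mem] conjI ballI)
      fix p assume p: "p \<in> A"
      note c = comb[of "d (Inl p) + snd p" "e (Inl p) + snd p"]
      show "0 \<le> u * (d (Inl p) + snd p) + (1 - u) * (e (Inl p) + snd p)"
        "ennreal u * k (fst p) + ennreal (1 - u) * l (fst p) =
          ennreal (u * (d (Inl p) + snd p) + (1 - u) * (e (Inl p) + snd p))"
        using c k(2)[OF p] l(2)[OF p] by auto
    next
      fix p assume p: "p \<in> B"
      note c = comb[of "snd p - d (Inr p)" "snd p - e (Inr p)"]
      show "0 \<le> u * (snd p - d (Inr p)) + (1 - u) * (snd p - e (Inr p))"
        using c k(3)[OF p] l(3)[OF p] by auto
      have "ennreal u * ennreal (snd p - d (Inr p)) + ennreal (1 - u) * ennreal (snd p - e (Inr p))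
          \<le> ennreal u * k (fst p) + ennreal (1 - u) * l (fst p)"
        using k(3)[OF p] l(3)[OF p] by (intro add_mono mult_left_mono) auto
      then show "ennreal (u * (snd p - d (Inr p)) + (1 - u) * (snd p - e (Inr p)))
          \<le> ennreal u * k (fst p) + ennreal (1 - u) * l (fst p)"
        using c k(3)[OF p] l(3)[OF p] by simp
    qed
  qed
  moreover have "\<exists>i\<in>A <+> B. 0 \<le> d i" if d: "d \<in> D" for d
  proof (rule ccontr)
    assume "\<not> ?thesis"
    then have neg: "\<And>p. p \<in> A \<Longrightarrow> d (Inl p) < 0" "\<And>p. p \<in> B \<Longrightarrow> d (Inr p) < 0"
      by (force simp: not_le)+
    obtain l where l: "l \<in> K"
      "\<And>p. p \<in> A \<Longrightarrow> 0 \<le> d (Inl p) + snd p \<and> l (fst p) = ennreal (d (Inl p) + snd p)"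
      "\<And>p. p \<in> B \<Longrightarrow> 0 \<le> snd p - d (Inr p) \<and> ennreal (snd p - d (Inr p)) \<le> l (fst p)"
      using d unfolding D_def by blast
    have "l x < ennreal a" if "(x, a) \<in> A" for x a
      using l(2)[OF that] neg(1)[OF that] by (simp add: ennreal_less_iff)
    moreover have "ennreal b < l y" if "(y, b) \<in> B" for y b
    proof -
      have "ennreal b < ennreal (b - d (Inr (y, b)))"
        using neg(2)[OF that] B[OF that] by (simp add: ennreal_less_iff)
      also have "\<dots> \<le> l y" using l(3)[OF that] by simp
      finally show ?thesis .
    qed
    ultimately show False using alt[OF l(1)] by (auto simp: not_less[symmetric])
  qed
  ultimately have "\<exists>\<phi>. (\<forall>i\<in>A <+> B. 0 \<le> \<phi> i) \<and> (\<exists>i\<in>A <+> B. 0 < \<phi> i) \<and>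
      (\<forall>d\<in>D. 0 \<le> (\<Sum>i\<in>A <+> B. \<phi> i * d i))"
    by (rule convex_alternative[OF finite_Plus[OF fin]])
  then obtain \<phi> where \<phi>: "\<forall>i\<in>A <+> B. 0 \<le> \<phi> i" "\<exists>i\<in>A <+> B. 0 < \<phi> i"
    "\<forall>d\<in>D. 0 \<le> (\<Sum>i\<in>A <+> B. \<phi> i * d i)"
    by (elim exE conjE)
  define \<alpha> where "\<alpha> p = \<phi> (Inl p)" for p
  define \<beta> where "\<beta> p = \<phi> (Inr p)" for p
  have nonneg: "\<And>p. p \<in> A \<Longrightarrow> 0 \<le> \<alpha> p" "\<And>p. p \<in> B \<Longrightarrow> 0 \<le> \<beta> p"
    using \<phi>(1) by (auto simp: \<alpha>_def \<beta>_def)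
  have ineq: "0 \<le> k * ((\<Sum>p\<in>A. \<alpha> p * s p) - (\<Sum>p\<in>B. \<beta> p * t p))
      - ((\<Sum>p\<in>A. \<alpha> p * snd p) - (\<Sum>p\<in>B. \<beta> p * snd p))"
    if "l \<in> K" "\<And>p. p \<in> A \<Longrightarrow> 0 \<le> s p \<and> l (fst p) = ennreal (s p)"
      "\<And>p. p \<in> B \<Longrightarrow> 0 \<le> t p \<and> ennreal (t p) \<le> l (fst p)" "0 < k" for l s t k
  proof -
    have "0 \<le> (\<Sum>i\<in>A <+> B. \<phi> i *
        case_sum (\<lambda>p. k * s p - snd p) (\<lambda>p. snd p - k * t p) i)"
      using \<phi>(3) D_mem[OF that] by blast
    also have "\<dots> = (\<Sum>p\<in>A. \<alpha> p * (k * s p - snd p)) + (\<Sum>p\<in>B. \<beta> p * (snd p - k * t p))"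
      using fin by (simp add: sum.Plus \<alpha>_def \<beta>_def)
    finally show ?thesis
      by (simp add: sum_subtractf sum_distrib_left algebra_simps)
  qed
  \<comment> \<open>At the zero functional only the constant term of the affine inequality
    remains.\<close>
  have le: "(\<Sum>p\<in>A. \<alpha> p * snd p) \<le> (\<Sum>p\<in>B. \<beta> p * snd p)"
    using ineq[OF zero, of "\<lambda>_. 0" "\<lambda>_. 0" 1] by simp
  have pos: "\<exists>p\<in>B. 0 < \<beta> p"
  proof (rule ccontr)
    \<comment> \<open>Otherwise the positive coefficient sits in \<open>A\<close>, whose thresholds
      are positive, so the left side of \<open>le\<close> would be positive and the right side
      zero.\<close>
    assume "\<not> ?thesis"
    then have "\<And>p. p \<in> B \<Longrightarrow> \<beta> p = 0" using nonneg(2) by force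
    with le have "(\<Sum>p\<in>A. \<alpha> p * snd p) \<le> 0" by simp
    moreover obtain p where "p \<in> A" "0 < \<alpha> p"
      using \<phi>(2) \<open>\<And>p. p \<in> B \<Longrightarrow> \<beta> p = 0\<close> by (force simp: \<alpha>_def \<beta>_def)
    moreover have "0 < snd p" using A[of "fst p" "snd p"] \<open>p \<in> A\<close> by simp
    ultimately have "0 < (\<Sum>p\<in>A. \<alpha> p * snd p)"
      using nonneg(1) A fin by (intro sum_pos2[of A p]) (auto simp: less_imp_le)
    with \<open>(\<Sum>p\<in>A. \<alpha> p * snd p) \<le> 0\<close> show False by simp
  qed
  have hom: "(\<Sum>p\<in>B. \<beta> p * t p) \<le> (\<Sum>p\<in>A. \<alpha> p * s p)"
    if "l \<in> K" "\<And>p. p \<in> A \<Longrightarrow> 0 \<le> s p \<and> l (fst p) = ennreal (s p)"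
      "\<And>p. p \<in> B \<Longrightarrow> 0 \<le> t p \<and> ennreal (t p) \<le> l (fst p)" for l s t
  proof (rule ccontr)
    let ?d = "(\<Sum>p\<in>A. \<alpha> p * s p) - (\<Sum>p\<in>B. \<beta> p * t p)"
    let ?c = "(\<Sum>p\<in>A. \<alpha> p * snd p) - (\<Sum>p\<in>B. \<beta> p * snd p)"
    assume "\<not> ?thesis"
    then have d: "?d < 0" by simp
    \<comment> \<open>Solves \<open>k * ?d = ?c - 1\<close>, so that scaling by \<open>k\<close>
      turns \<open>ineq\<close> into \<open>0 \<le> -1\<close>. By \<open>le\<close>,
      \<open>?c\<close> is at most 0, hence \<open>k\<close> is positive.\<close>
    define k where "k = (1 - ?c) / (- ?d)"
    have "0 < k" using d le by (simp add: k_def)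
    moreover have "k * ?d = ?c - 1"
      using d by (simp add: k_def divide_simps) (simp add: algebra_simps)
    ultimately show False using ineq[OF that, of k] by linarith
  qed
  show thesis
    using nonneg pos le hom by (intro that[of \<alpha> \<beta>]) simp_all
qed

theorem theoremA11:
  fixes K :: "('a::cu_semigroup_O5 \<Rightarrow> ennreal) set" and \<mu> :: "'a \<Rightarrow> ennreal"
  assumes "subcone K" and "closedin functional_topology K"
    and "(\<lambda>x. 0) \<in> K"
    and "\<mu> \<in> functionals - K"
  shows "\<exists>x y. (\<forall>l\<in>K. hat x l \<le> hat y l) \<and> hat x \<mu> > hat y \<mu>"
proof -

  \<comment> \<open>A real linear inequality separating \<open>K\<close> from
    \<open>\<mu>\<close>\<close>
  obtain A B :: "('a \<times> real) set" where fin: "finite A" "finite B"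
    and A: "\<And>x a. (x, a) \<in> A \<Longrightarrow> \<mu> x < ennreal a"
    and B: "\<And>y b. (y, b) \<in> B \<Longrightarrow> 0 \<le> b \<and> ennreal b < \<mu> y"
    and alt: "\<And>l. l \<in> K \<Longrightarrow> (\<exists>(x, a)\<in>A. ennreal a \<le> l x) \<or> (\<exists>(y, b)\<in>B. l y \<le> ennreal b)"
    using closedin_functional_topology_pointwise[OF assms(2,4)] by metis
  have A0: "0 < a" if "(x, a) \<in> A" for x a
    using A[OF that] by (metis ennreal_neg not_le not_less_zero)
  have B0: "0 \<le> b" if "(y, b) \<in> B" for y b
    using B[OF that] by blast
  obtain \<alpha> \<beta> where \<alpha>_nonneg: "\<forall>p\<in>A. 0 \<le> \<alpha> p" and \<beta>_nonneg: "\<forall>p\<in>B. 0 \<le> \<beta> p"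
    and \<beta>_pos: "\<exists>p\<in>B. 0 < \<beta> p"
    and at_\<mu>: "(\<Sum>p\<in>A. \<alpha> p * snd p) \<le> (\<Sum>p\<in>B. \<beta> p * snd p)"
    and K_ineq: "\<forall>l\<in>K. \<forall>s t. (\<forall>p\<in>A. 0 \<le> s p \<and> l (fst p) = ennreal (s p)) \<longrightarrow>
       (\<forall>p\<in>B. 0 \<le> t p \<and> ennreal (t p) \<le> l (fst p)) \<longrightarrow>
       (\<Sum>p\<in>B. \<beta> p * t p) \<le> (\<Sum>p\<in>A. \<alpha> p * s p)"
    by (rule subcone_pointwise_alternative[OF assms(1,3) fin A0 B0 alt])
  note \<alpha> = \<alpha>_nonneg[rule_format] and \<beta> = \<beta>_nonneg[rule_format]
  have on_K: "(\<Sum>p\<in>B. \<beta> p * t p) \<le> (\<Sum>p\<in>A. \<alpha> p * s p)"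
    if "l \<in> K" "\<And>p. p \<in> A \<Longrightarrow> 0 \<le> s p \<and> l (fst p) = ennreal (s p)"
      "\<And>p. p \<in> B \<Longrightarrow> 0 \<le> t p \<and> ennreal (t p) \<le> l (fst p)" for l s t
    using K_ineq that by simp
  \<comment> \<open>Raising each lower threshold strictly while staying below \<open>\<mu>\<close>
    turns the weak inequality at \<open>\<mu>\<close> into a strict one, because some
    \<open>\<beta> p\<close> is positive. The new thresholds are finite even where
    \<open>\<mu>\<close> is infinite.\<close>
  have "\<exists>r. snd p < r \<and> ennreal r < \<mu> (fst p)" if "p \<in> B" for p
  proof -
    from that have p: "0 \<le> snd p" "ennreal (snd p) < \<mu> (fst p)"
      using B[of "fst p" "snd p"] by auto
    then obtain z where z: "ennreal (snd p) < z" "z < \<mu> (fst p)" using dense[OF p(2)] by blast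
    then obtain r where "z = ennreal r" "0 \<le> r" by (cases z) auto
    with z p show ?thesis by (auto simp: ennreal_less_iff)
  qed
  then obtain t where t: "\<And>p. p \<in> B \<Longrightarrow> snd p < t p" "\<And>p. p \<in> B \<Longrightarrow> ennreal (t p) < \<mu> (fst p)"
    by metis
  have t0: "0 \<le> t p" if "p \<in> B" for p
    using t(1)[OF that] B0[of "fst p" "snd p"] that by simp
  have "(\<Sum>p\<in>B. \<beta> p * snd p) < (\<Sum>p\<in>B. \<beta> p * t p)"
  proof (rule sum_strict_mono_ex1[OF fin(2)])
    show "\<forall>p\<in>B. \<beta> p * snd p \<le> \<beta> p * t p"
      using \<beta> t(1) by (intro ballI mult_left_mono) (simp_all add: less_imp_le)
    show "\<exists>p\<in>B. \<beta> p * snd p < \<beta> p * t p"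
      using \<beta>_pos t(1) mult_strict_left_mono by blast
  qed
  with at_\<mu> have gap: "0 < (\<Sum>p\<in>B. \<beta> p * t p) - (\<Sum>p\<in>A. \<alpha> p * snd p)" by linarith
  \<comment> \<open>Rounding changes each coefficient by at most 1, so it costs at most the sum of
    the thresholds; \<open>N\<close> makes the scaled gap larger than that.\<close>
  then obtain N :: nat where N: "(\<Sum>p\<in>B. t p) + (\<Sum>p\<in>A. snd p)
      < real N * ((\<Sum>p\<in>B. \<beta> p * t p) - (\<Sum>p\<in>A. \<alpha> p * snd p))"
    using reals_Archimedean3 by blast
  define n where "n p = nat \<lfloor>real N * \<beta> p\<rfloor>" for p
  \<comment> \<open>\<open>Suc\<close> of the floor rather than the ceiling, so that
    \<open>m p\<close> is positive even when \<open>\<alpha> p\<close> is 0.\<close>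
  define m where "m p = Suc (nat \<lfloor>real N * \<alpha> p\<rfloor>)" for p
  have n: "real (n p) \<le> real N * \<beta> p" "real N * \<beta> p - 1 \<le> real (n p)" if "p \<in> B" for p
    using \<beta>[OF that] unfolding n_def by (simp, linarith)
  have m: "real N * \<alpha> p \<le> real (m p)" "real (m p) \<le> real N * \<alpha> p + 1" if "p \<in> A" for p
    using \<alpha>[OF that] unfolding m_def by (linarith, simp)
  define x where "x = (\<Sum>p\<in>B. \<Sum>k<n p. fst p)"
  define y where "y = (\<Sum>p\<in>A. \<Sum>k<m p. fst p)"
  have hat_x: "hat x l = (\<Sum>p\<in>B. of_nat (n p) * l (fst p))"
    and hat_y: "hat y l = (\<Sum>p\<in>A. of_nat (m p) * l (fst p))" if "l \<in> functionals" for l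
    by (simp_all only: hat_def x_def y_def functional_sum_multiples[OF that fin(1)]
      functional_sum_multiples[OF that fin(2)])

  \<comment> \<open>The comparison on \<open>K\<close>\<close>
  have "hat x l \<le> hat y l" if l: "l \<in> K" for l
  proof (cases "\<exists>p\<in>A. l (fst p) = \<infinity>")
    \<comment> \<open>As \<open>m p\<close> is positive, the infinite value survives multiplication
      and makes \<open>hat y l\<close> infinite.\<close>
    case True
    then obtain p where "p \<in> A" "of_nat (m p) * l (fst p) = \<infinity>"
      by (auto simp: m_def ennreal_mult_eq_top_iff)
    then have "(\<Sum>p\<in>A. of_nat (m p) * l (fst p)) = \<infinity>"
      using fin by (auto simp: ennreal_sum_eq_top)
    moreover have "l \<in> functionals" using l assms(1) by (auto simp: subcone_def)
    ultimately show ?thesis by (simp add: hat_y)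
  next
    case False
    define s where "s p = enn2real (l (fst p))" for p :: "'a \<times> real"
    have s: "0 \<le> s p \<and> l (fst p) = ennreal (s p)" if "p \<in> A" for p
      using False that by (auto simp: s_def less_top)
    \<comment> \<open>A positive \<open>n q\<close> forces a positive \<open>\<beta> q\<close>. If
      \<open>l\<close> were infinite at \<open>q\<close>, every real would be an admissible lower
      bound there; \<open>T\<close> at \<open>q\<close> and 0 elsewhere violates \<open>on_K\<close>
      by exactly 1.\<close>
    have fin_B: "l (fst q) \<noteq> \<infinity>" if q: "q \<in> B" "0 < n q" for q
    proof
      assume inf: "l (fst q) = \<infinity>"
      have "0 < real N * \<beta> q" using n(1)[OF q(1)] q(2) by linarith
      then have pos: "0 < \<beta> q" using \<beta>[OF q(1)] by (auto simp: zero_less_mult_iff)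
      define T where "T = ((\<Sum>p\<in>A. \<alpha> p * s p) + 1) / \<beta> q"
      have nn: "0 \<le> (\<Sum>p\<in>A. \<alpha> p * s p)" using \<alpha> s by (auto intro: sum_nonneg)
      have "(\<Sum>p\<in>B. \<beta> p * (if p = q then T else 0)) \<le> (\<Sum>p\<in>A. \<alpha> p * s p)"
        using nn pos by (intro on_K[OF l s]) (auto simp: inf T_def)
      moreover have "(\<Sum>p\<in>B. \<beta> p * (if p = q then T else 0)) = \<beta> q * T"
        using q fin by (simp add: if_distrib cong: if_cong)
      ultimately show False using pos by (simp add: T_def)
    qed
    have fun_l: "l \<in> functionals" using l assms(1) by (auto simp: subcone_def)
    \<comment> \<open>\<open>enn2real\<close> sends infinity to 0, so \<open>s p\<close> is a finite
      lower bound at every point and can be used in \<open>on_K\<close> for \<open>B\<close> as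
      well. By \<open>fin_B\<close> it is the exact value wherever \<open>n p\<close> is
      positive.\<close>
    have s_B: "0 \<le> s p \<and> ennreal (s p) \<le> l (fst p)" for p
      unfolding s_def by (cases "l (fst p)") auto
    have "hat x l = (\<Sum>p\<in>B. ennreal (real (n p) * s p))"
      unfolding hat_x[OF fun_l]
    proof (rule sum.cong)
      fix p assume "p \<in> B"
      then show "of_nat (n p) * l (fst p) = ennreal (real (n p) * s p)"
        using fin_B[of p] by (cases "n p = 0")
          (auto simp: s_def ennreal_mult less_top simp flip: ennreal_of_nat_eq_real_of_nat)
    qed simp
    also have "\<dots> = ennreal (\<Sum>p\<in>B. real (n p) * s p)"
      using s_B by (simp add: sum_ennreal)
    also have "\<dots> \<le> ennreal (\<Sum>p\<in>A. real (m p) * s p)"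
    proof (rule ennreal_leI)
      have "(\<Sum>p\<in>B. real (n p) * s p) \<le> (\<Sum>p\<in>B. real N * \<beta> p * s p)"
        using n s_B by (intro sum_mono mult_right_mono) auto
      also have "\<dots> = real N * (\<Sum>p\<in>B. \<beta> p * s p)"
        by (simp add: sum_distrib_left mult.assoc)
      also have "\<dots> \<le> real N * (\<Sum>p\<in>A. \<alpha> p * s p)"
        by (intro mult_left_mono on_K[OF l s s_B]) auto
      also have "\<dots> = (\<Sum>p\<in>A. real N * \<alpha> p * s p)"
        by (simp add: sum_distrib_left mult.assoc)
      also have "\<dots> \<le> (\<Sum>p\<in>A. real (m p) * s p)"
        using m s_B by (intro sum_mono mult_right_mono) auto
      finally show "(\<Sum>p\<in>B. real (n p) * s p) \<le> (\<Sum>p\<in>A. real (m p) * s p)" .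
    qed
    also have "\<dots> = (\<Sum>p\<in>A. ennreal (real (m p) * s p))"
      using s_B by (simp add: sum_ennreal)
    also have "\<dots> = hat y l"
      unfolding hat_y[OF fun_l]
      by (rule sum.cong) (use s in \<open>auto simp: ennreal_mult ennreal_of_nat_eq_real_of_nat\<close>)
    finally show ?thesis .
  qed

  \<comment> \<open>The strict inequality at \<open>\<mu>\<close>\<close>
  moreover have "hat y \<mu> < hat x \<mu>"
  proof -
    have \<mu>: "\<mu> \<in> functionals" using assms(4) by blast
    have snd_A: "0 \<le> snd p" if "p \<in> A" for p
      using A0[of "fst p" "snd p"] that by simp
    \<comment> \<open>Replacing the values of \<open>\<mu>\<close> by the thresholds above them on
      \<open>A\<close> and below them on \<open>B\<close> reduces the claim to finite sums of reals,
      where the choice of \<open>N\<close> decides.\<close>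
    have "hat y \<mu> \<le> (\<Sum>p\<in>A. ennreal (real (m p) * snd p))"
      unfolding hat_y[OF \<mu>]
    proof (rule sum_mono)
      fix p assume "p \<in> A"
      then show "of_nat (m p) * \<mu> (fst p) \<le> ennreal (real (m p) * snd p)"
        using A[of "fst p" "snd p"] snd_A[of p]
        by (auto simp: ennreal_mult ennreal_of_nat_eq_real_of_nat intro!: mult_left_mono)
    qed
    also have "\<dots> = ennreal (\<Sum>p\<in>A. real (m p) * snd p)"
      using snd_A by (simp add: sum_ennreal)
    also have "\<dots> < ennreal (\<Sum>p\<in>B. real (n p) * t p)"
    proof -
      have "(\<Sum>p\<in>A. real (m p) * snd p) \<le> (\<Sum>p\<in>A. (real N * \<alpha> p + 1) * snd p)"
        using m snd_A by (intro sum_mono mult_right_mono) auto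
      also have "\<dots> = real N * (\<Sum>p\<in>A. \<alpha> p * snd p) + (\<Sum>p\<in>A. snd p)"
        by (simp add: sum_distrib_left sum.distrib algebra_simps)
      also have "\<dots> < real N * (\<Sum>p\<in>B. \<beta> p * t p) - (\<Sum>p\<in>B. t p)"
        using N by (simp add: algebra_simps)
      also have "\<dots> = (\<Sum>p\<in>B. (real N * \<beta> p - 1) * t p)"
        by (simp add: sum_distrib_left sum_subtractf algebra_simps)
      also have "\<dots> \<le> (\<Sum>p\<in>B. real (n p) * t p)"
        using n t0 by (intro sum_mono mult_right_mono) auto
      finally show ?thesis
        using snd_A by (simp add: ennreal_less_iff sum_nonneg)
    qed
    also have "\<dots> = (\<Sum>p\<in>B. ennreal (real (n p) * t p))"
      using t0 by (simp add: sum_ennreal)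
    also have "\<dots> \<le> hat x \<mu>"
      unfolding hat_x[OF \<mu>]
    proof (rule sum_mono)
      fix p assume "p \<in> B"
      then show "ennreal (real (n p) * t p) \<le> of_nat (n p) * \<mu> (fst p)"
        using t[of p] t0[of p]
        by (auto simp: ennreal_mult ennreal_of_nat_eq_real_of_nat intro!: mult_left_mono)
    qed
    finally show ?thesis .
  qed
  ultimately show ?thesis by blast
qed

end
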